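(* Let Assumptions 1 and 2 of the context hold and let $x_0\in\mathsf X_0$. Let $\{x_k^\star,\lambda_k^i,\ k\in\mathsf K,\ \mu_k^{i\star},\ k\in\mathsf K_l,\ i\in\mathsf N\}$ be a solution of LCS1. For all $i\in\mathsf N$ construct the control sequence $$\bar u_k^i=-(R_k^{ii})^{-1}\big({B_k^i}'\lambda_{k+1}^i-[N_k^i]_i'\mu_k^{i\star}\big),\quad k\in\mathsf K_l,$$ and define $$e_k^i=\lambda_k^i-E_k^ix_k^\star,\quad k\in\mathsf K,$$ $$b_k^i=(Y_k^i)^{-1}\Big({B_k^i}'\big(E_{k+1}^i\sum_{j\in-i}B_k^j\bar u_k^j+e_{k+1}^i\big)-[N_k^i]_i'\mu_k^{i\star}\Big),\quad k\in\mathsf K_l,\qquad b_K^i=0.$$ Then the derived sequence, with $\bar x_k=x_k^\star$, $\bar\mu_k^i=\mu_k^{i\star}$ and these $e_k^i$, $b_k^i$, is a consistent solution of LCS2 with parameters $\boldsymbol\mu^\star=\{\mu_k^{i\star}\}$.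
   Context: Notation. A prime denotes transpose; $\|a\|_A:=a'Aa$; $\mathrm{col}\{\cdot\}$ stacks vectors or matrices vertically; $0\le x\perp y\ge0$ means $x\ge0$, $y\ge0$ (componentwise) and $x'y=0$. $\mathsf N=\{1,\dots,N\}$ (players), $\mathsf K=\{0,\dots,K\}$, $\mathsf K_l=\mathsf K\setminus\{K\}$, $-i=\mathsf N\setminus\{i\}$. The game (DGC). The state $x_k\in\mathbb R^n$ evolves as $x_{k+1}=A_kx_k+\sum_{i\in\mathsf N}B_k^iu_k^i$, $k\in\mathsf K_l$, with given $x_0\in\mathbb R^n$, where $A_k\in\mathbb R^{n\times n}$, $B_k^i\in\mathbb R^{n\times m_i}$ and $u_k^i\in\mathbb R^{m_i}$ is player $i$'s action. Put $\mathsf u_k=\mathrm{col}\{u_k^i\}_{i=1}^N\in\mathbb R^m$, $m=\sum_im_i$. Player $i$'s constraints are $M_k^ix_k+N_k^i\mathsf u_k+r_k^i\ge0$, $k\in\mathsf K_l$, with $M_k^i\in\mathbb R^{c_i\times n}$, $N_k^i\in\mathbb R^{c_i\times m}$, $r_k^i\in\mathbb R^{c_i}$; $[N_k^i]_j\in\mathbb R^{c_i\times m_j}$ is the block of columns of $N_k^i$ multiplying $u_k^j$. Player $i$'s strategy is $\mathsf u^i=\mathrm{col}\{u_k^i\}_{k=0}^{K-1}$, and $\mathsf u^{-i}$ collects the strategies of the other players. Player $i$ minimizes $$J^i(\mathsf u^i,\mathsf u^{-i})=\tfrac12\|x_K\|_{Q_K^i}+{p_K^i}'x_K+\tfrac12\sum_{k\in\mathsf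 K_l}\Big(\|x_k\|_{Q_k^i}+2{p_k^i}'x_k+\sum_{j\in\mathsf N}\|u_k^j\|_{R_k^{ij}}\Big),$$ with $Q_k^i\in\mathbb R^{n\times n}$ symmetric, $p_k^i\in\mathbb R^n$, $R_k^{ij}\in\mathbb R^{m_j\times m_j}$, $R_k^{ii}$ symmetric. $R(x_0)$ is the set of joint strategies $(\mathsf u^i,\mathsf u^{-i})\in\mathbb R^{Km}$ for which, with the state generated from $x_0$, all players' constraints hold at all $k\in\mathsf K_l$; $\Omega=\{(x_0,(\mathsf u^i,\mathsf u^{-i})):(\mathsf u^i,\mathsf u^{-i})\in R(x_0)\}$; $\mathsf X_0=\{x_0\in\mathbb R^n: R(x_0)\ne\emptyset\}$. Assumption 1. (i) $\Omega\ne\emptyset$, and for every $x_0\in\mathsf X_0$, $R(x_0)$ is bounded. (ii) The matrices $[N_k^i]_i$, $k\in\mathsf K_l$, $i\in\mathsf N$, have full rank. (iii) The matrices $R_k^{ii}$, $k\in\mathsf K_l$, $i\in\mathsf N$, are positive definite. Assumption 2. For each $i\in\mathsf N$ the backward symmetric matrix Riccati equation $$E_k^i=A_k'E_{k+1}^iA_k+Q_k^i-A_k'E_{k+1}^iB_k^i(Y_k^i)^{-1}{B_k^i}'E_{k+1}^iA_k,\quad E_K^i=Q_K^i,$$ admits a solution $\{E_k^i,\ k\in\mathsf K\}$, and thus the matrices $Y_k^i=R_k^{ii}+{B_k^i}'E_{k+1}^iB_k^i$, $k\in\mathsf K_l$, $i\in\mathsf N$, are invertible. LCS1. A solution of LCS1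 is a collection $\{x_k^\star,\lambda_k^i\in\mathbb R^n,\ k\in\mathsf K,\ \mu_k^{i\star}\in\mathbb R^{c_i},\ k\in\mathsf K_l,\ i\in\mathsf N\}$ such that for all $k\in\mathsf K_l$, $i\in\mathsf N$ $$x_{k+1}^\star=A_kx_k^\star-\sum_{j\in\mathsf N}B_k^j(R_k^{jj})^{-1}\big({B_k^j}'\lambda_{k+1}^j-[N_k^j]_j'\mu_k^{j\star}\big),$$ $$\lambda_k^i=Q_k^ix_k^\star+p_k^i+A_k'\lambda_{k+1}^i-{M_k^i}'\mu_k^{i\star},$$ $$0\le M_k^ix_k^\star-\sum_{j\in\mathsf N}[N_k^i]_j(R_k^{jj})^{-1}\big({B_k^j}'\lambda_{k+1}^j-[N_k^j]_j'\mu_k^{j\star}\big)+r_k^i\ \perp\ \mu_k^{i\star}\ge0,$$ with $x_0^\star=x_0$ and $\lambda_K^i=Q_K^ix_K^\star+p_K^i$. LCS2. Let parameters $\boldsymbol\mu^\star=\{\mu_k^{i\star}\in\mathbb R^{c_i}\}$ be given. A solution of LCS2 with parameters $\boldsymbol\mu^\star$ is a collection $\{\bar x_k,e_k^i\in\mathbb R^n,\ b_k^i\in\mathbb R^{m_i},\ k\in\mathsf K,\ \bar\mu_k^i\in\mathbb R^{c_i},\ k\in\mathsf K_l,\ i\in\mathsf N\}$ such that for all $k\in\mathsf K_l$, $i\in\mathsf N$ $$\bar x_{k+1}=\big(\mathbf I-B_k^i(Y_k^i)^{-1}{B_k^i}'E_{k+1}^i\big)A_k\bar x_k-B_k^ib_k^i+B_k^i(Y_k^i)^{-1}\beta_k^i+\bar\eta_k^i,$$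 $$e_k^i=A_k'e_{k+1}^i+A_k'E_{k+1}^i\bar\eta_k^i-A_k'E_{k+1}^iB_k^ib_k^i+p_k^i-{M_k^i}'\mu_k^{i\star},$$ $$0\le[N_k^i]_i(Y_k^i)^{-1}\beta_k^i+\big(M_k^i-[N_k^i]_i(Y_k^i)^{-1}{B_k^i}'E_{k+1}^iA_k\big)\bar x_k-[N_k^i]_ib_k^i+\bar\alpha_k^i+r_k^i\ \perp\ \bar\mu_k^i\ge0,$$ $$Y_k^ib_k^i={B_k^i}'(E_{k+1}^i\bar\eta_k^i+e_{k+1}^i)-[N_k^i]_i'\mu_k^{i\star},$$ with $\bar x_0=x_0$, $e_K^i=p_K^i$, $b_K^i=0$, where $$\bar\eta_k^i=\sum_{j\in-i}B_k^j\bar u_k^j,\quad \bar\alpha_k^i=\sum_{j\in-i}[N_k^i]_j\bar u_k^j,\quad \bar u_k^i=-(Y_k^i)^{-1}{B_k^i}'E_{k+1}^iA_k\bar x_k-b_k^i+(Y_k^i)^{-1}\beta_k^i,$$ $$\beta_k^i=[N_k^i]_i'(\bar\mu_k^i-\mu_k^{i\star})+\sum_{\tau=k+1}^{K-1}(A_{\tau-1}\cdots A_{k+1}B_k^i)'{M_\tau^i}'(\bar\mu_\tau^i-\mu_\tau^{i\star})$$ (for $\tau=k+1$ the product $A_{\tau-1}\cdots A_{k+1}$ is the identity). The solution is called consistent if $\bar\mu_k^i=\mu_k^{i\star}$ for all $k\in\mathsf K_l$, $i\in\mathsf N$. *)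

theory Defs
  imports
    "Jordan_Normal_Form.Gauss_Jordan_Elimination"
    "Jordan_Normal_Form.DL_Rank"
    "HOL-Library.FuncSet"
begin

text \<open>
  The action and constraint dimensions vary with the player, hence matrices and vectors with
  explicit carriers. Throughout, player indices come before the time index: \<open>Bm G i k\<close> is
  $B_k^i$ and \<open>Rm G i j k\<close> is $R_k^{ij}$. The matrix \<open>Nm G i k\<close> acts on the stacked actions of
  all players.
\<close>

record dgc =
  nplayers :: nat
  horizon :: nat
  xdim :: nat
  udim :: "nat \<Rightarrow> nat"
  cdim :: "nat \<Rightarrow> nat"
  Am :: "nat \<Rightarrow> real mat"
  Bm :: "nat \<Rightarrow> nat \<Rightarrow> real mat"
  Mm :: "nat \<Rightarrow> nat \<Rightarrow> real mat"
  Nm :: "nat \<Rightarrow> nat \<Rightarrow> real mat"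
  rv :: "nat \<Rightarrow> nat \<Rightarrow> real vec"
  Qm :: "nat \<Rightarrow> nat \<Rightarrow> real mat"
  pv :: "nat \<Rightarrow> nat \<Rightarrow> real vec"
  Rm :: "nat \<Rightarrow> nat \<Rightarrow> nat \<Rightarrow> real mat"

definition players :: "dgc \<Rightarrow> nat set" where
  "players G = {1..nplayers G}"

definition stages :: "dgc \<Rightarrow> nat set" where
  "stages G = {..horizon G}"

definition ctrl_stages :: "dgc \<Rightarrow> nat set" where
  "ctrl_stages G = {..<horizon G}"

definition valid_dgc :: "dgc \<Rightarrow> bool" where
  "valid_dgc G \<longleftrightarrow>
     (\<forall>k\<in>ctrl_stages G. Am G k \<in> carrier_mat (xdim G) (xdim G)) \<and>
     (\<forall>i\<in>players G. \<forall>k\<in>ctrl_stages G.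
        Bm G i k \<in> carrier_mat (xdim G) (udim G i) \<and>
        Mm G i k \<in> carrier_mat (cdim G i) (xdim G) \<and>
        Nm G i k \<in> carrier_mat (cdim G i) (\<Sum>j\<in>players G. udim G j) \<and>
        rv G i k \<in> carrier_vec (cdim G i) \<and>
        (\<forall>j\<in>players G. Rm G i j k \<in> carrier_mat (udim G j) (udim G j)) \<and>
        transpose_mat (Rm G i i k) = Rm G i i k) \<and>
     (\<forall>i\<in>players G. \<forall>k\<in>stages G.
        Qm G i k \<in> carrier_mat (xdim G) (xdim G) \<and>
        transpose_mat (Qm G i k) = Qm G i k \<and>
        pv G i k \<in> carrier_vec (xdim G))"

abbreviation vsum :: "nat \<Rightarrow> ('i \<Rightarrow> real vec) \<Rightarrow> 'i set \<Rightarrow> real vec" where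
  "vsum d \<equiv> finsum_vec TYPE(real) d"

text \<open>The inverse of an invertible matrix; unspecified for a singular one.\<close>

definition minv :: "real mat \<Rightarrow> real mat" where
  "minv A = the (mat_inverse A)"

definition qform :: "real mat \<Rightarrow> real vec \<Rightarrow> real" where
  "qform A a = a \<bullet> (A *\<^sub>v a)"

definition pos_def :: "nat \<Rightarrow> real mat \<Rightarrow> bool" where
  "pos_def d A \<longleftrightarrow> A \<in> carrier_mat d d \<and> (\<forall>a\<in>carrier_vec d. a \<noteq> 0\<^sub>v d \<longrightarrow> qform A a > 0)"

definition full_rank :: "nat \<Rightarrow> nat \<Rightarrow> real mat \<Rightarrow> bool" where
  "full_rank nr nc A \<longleftrightarrow> A \<in> carrier_mat nr nc \<and> vec_space.rank nr A = min nr nc"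

definition complementary :: "nat \<Rightarrow> real vec \<Rightarrow> real vec \<Rightarrow> bool" where
  "complementary d a b \<longleftrightarrow> 0\<^sub>v d \<le> a \<and> 0\<^sub>v d \<le> b \<and> a \<bullet> b = 0"

text \<open>\<open>Nblk G i j k\<close> is $[N_k^i]_j$, the columns of $N_k^i$ that multiply $u_k^j$.\<close>

definition Nblk :: "dgc \<Rightarrow> nat \<Rightarrow> nat \<Rightarrow> nat \<Rightarrow> real mat" where
  "Nblk G i j k =
     mat (cdim G i) (udim G j) (\<lambda>(r, s). Nm G i k $$ (r, (\<Sum>l\<in>{1..<j}. udim G l) + s))"

definition ustack :: "dgc \<Rightarrow> (nat \<Rightarrow> nat \<Rightarrow> real vec) \<Rightarrow> nat \<Rightarrow> real vec" where
  "ustack G u k = foldr (@\<^sub>v) (map (\<lambda>i. u i k) [1..<Suc (nplayers G)]) vNil"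

text \<open>Extensional functions, so that joint strategies correspond one-to-one to vectors in
  $R^{Km}$.\<close>

definition joint_strategies :: "dgc \<Rightarrow> (nat \<Rightarrow> nat \<Rightarrow> real vec) set" where
  "joint_strategies G =
     (\<Pi>\<^sub>E i\<in>players G. \<Pi>\<^sub>E k\<in>ctrl_stages G. carrier_vec (udim G i))"

primrec state :: "dgc \<Rightarrow> real vec \<Rightarrow> (nat \<Rightarrow> nat \<Rightarrow> real vec) \<Rightarrow> nat \<Rightarrow> real vec" where
  "state G x0 u 0 = x0"
| "state G x0 u (Suc k) =
     Am G k *\<^sub>v state G x0 u k + vsum (xdim G) (\<lambda>i. Bm G i k *\<^sub>v u i k) (players G)"

text \<open>The objective \<open>cost\<close> plays no role in the assumptions or in the two complementarity
  systems; it fixes the meaning of the data \<open>Qm\<close>, \<open>pv\<close> and \<open>Rm\<close>.\<close>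

definition cost :: "dgc \<Rightarrow> real vec \<Rightarrow> nat \<Rightarrow> (nat \<Rightarrow> nat \<Rightarrow> real vec) \<Rightarrow> real" where
  "cost G x0 i u =
     (let x = state G x0 u; K = horizon G in
      1/2 * qform (Qm G i K) (x K) + pv G i K \<bullet> x K +
      1/2 * (\<Sum>k\<in>ctrl_stages G. qform (Qm G i k) (x k) + 2 * (pv G i k \<bullet> x k) +
               (\<Sum>j\<in>players G. qform (Rm G i j k) (u j k))))"

definition feasible :: "dgc \<Rightarrow> real vec \<Rightarrow> (nat \<Rightarrow> nat \<Rightarrow> real vec) set" where
  "feasible G x0 =
     {u \<in> joint_strategies G. \<forall>i\<in>players G. \<forall>k\<in>ctrl_stages G.
        0\<^sub>v (cdim G i) \<le> Mm G i k *\<^sub>v state G x0 u k + Nm G i k *\<^sub>v ustack G u k + rv G i k}"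

definition feasible_pairs :: "dgc \<Rightarrow> (real vec \<times> (nat \<Rightarrow> nat \<Rightarrow> real vec)) set" where
  "feasible_pairs G = {(x0, u). x0 \<in> carrier_vec (xdim G) \<and> u \<in> feasible G x0}"

definition feasible_init :: "dgc \<Rightarrow> real vec set" where
  "feasible_init G = {x0 \<in> carrier_vec (xdim G). feasible G x0 \<noteq> {}}"

text \<open>Boundedness in the Euclidean norm of the stacked joint strategy.\<close>

definition bounded_strategies :: "dgc \<Rightarrow> (nat \<Rightarrow> nat \<Rightarrow> real vec) set \<Rightarrow> bool" where
  "bounded_strategies G S \<longleftrightarrow>
     (\<exists>C. \<forall>u\<in>S. sqrt (\<Sum>i\<in>players G. \<Sum>k\<in>ctrl_stages G. u i k \<bullet> u i k) \<le> C)"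

definition assumption1 :: "dgc \<Rightarrow> bool" where
  "assumption1 G \<longleftrightarrow>
     feasible_pairs G \<noteq> {} \<and>
     (\<forall>x0\<in>feasible_init G. bounded_strategies G (feasible G x0)) \<and>
     (\<forall>i\<in>players G. \<forall>k\<in>ctrl_stages G. full_rank (cdim G i) (udim G i) (Nblk G i i k)) \<and>
     (\<forall>i\<in>players G. \<forall>k\<in>ctrl_stages G. pos_def (udim G i) (Rm G i i k))"

definition Ym :: "dgc \<Rightarrow> (nat \<Rightarrow> nat \<Rightarrow> real mat) \<Rightarrow> nat \<Rightarrow> nat \<Rightarrow> real mat" where
  "Ym G E i k = Rm G i i k + transpose_mat (Bm G i k) * E i (k + 1) * Bm G i k"

text \<open>\<open>E\<close> is a solution of the backward Riccati equations of all players. The equations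
  determine \<open>E i k\<close> for all players and stages; symmetry is a consequence.\<close>

definition riccati_solution :: "dgc \<Rightarrow> (nat \<Rightarrow> nat \<Rightarrow> real mat) \<Rightarrow> bool" where
  "riccati_solution G E \<longleftrightarrow>
     (\<forall>i\<in>players G.
        (\<forall>k\<in>stages G. E i k \<in> carrier_mat (xdim G) (xdim G)) \<and>
        E i (horizon G) = Qm G i (horizon G) \<and>
        (\<forall>k\<in>ctrl_stages G.
           invertible_mat (Ym G E i k) \<and>
           E i k = transpose_mat (Am G k) * E i (k + 1) * Am G k + Qm G i k
             - transpose_mat (Am G k) * E i (k + 1) * Bm G i k * minv (Ym G E i k)
               * transpose_mat (Bm G i k) * E i (k + 1) * Am G k))"

definition lcs1_solution ::
  "dgc \<Rightarrow> real vec \<Rightarrow> (nat \<Rightarrow> real vec) \<Rightarrow> (nat \<Rightarrow> nat \<Rightarrow> real vec) \<Rightarrow> (nat \<Rightarrow> nat \<Rightarrow> real vec) \<Rightarrow> bool"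
where
  "lcs1_solution G x0 x lam mu \<longleftrightarrow>
     (\<forall>k\<in>stages G. x k \<in> carrier_vec (xdim G)) \<and>
     (\<forall>i\<in>players G. \<forall>k\<in>stages G. lam i k \<in> carrier_vec (xdim G)) \<and>
     (\<forall>i\<in>players G. \<forall>k\<in>ctrl_stages G. mu i k \<in> carrier_vec (cdim G i)) \<and>
     x 0 = x0 \<and>
     (\<forall>i\<in>players G. lam i (horizon G) = Qm G i (horizon G) *\<^sub>v x (horizon G) + pv G i (horizon G)) \<and>
     (\<forall>k\<in>ctrl_stages G.
        x (k + 1) = Am G k *\<^sub>v x k
          - vsum (xdim G) (\<lambda>j. Bm G j k *\<^sub>v (minv (Rm G j j k) *\<^sub>v
              (transpose_mat (Bm G j k) *\<^sub>v lam j (k + 1)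
                - transpose_mat (Nblk G j j k) *\<^sub>v mu j k))) (players G)) \<and>
     (\<forall>i\<in>players G. \<forall>k\<in>ctrl_stages G.
        lam i k = Qm G i k *\<^sub>v x k + pv G i k + transpose_mat (Am G k) *\<^sub>v lam i (k + 1)
          - transpose_mat (Mm G i k) *\<^sub>v mu i k \<and>
        complementary (cdim G i)
          (Mm G i k *\<^sub>v x k
            - vsum (cdim G i) (\<lambda>j. Nblk G i j k *\<^sub>v (minv (Rm G j j k) *\<^sub>v
                (transpose_mat (Bm G j k) *\<^sub>v lam j (k + 1)
                  - transpose_mat (Nblk G j j k) *\<^sub>v mu j k))) (players G)
            + rv G i k)
          (mu i k))"

text \<open>\<open>transition G t s\<close> is the product $A_{t-1} \cdots A_s$, the identity for \<open>t = s\<close>.\<close>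

definition transition :: "dgc \<Rightarrow> nat \<Rightarrow> nat \<Rightarrow> real mat" where
  "transition G t s = foldr (*) (rev (map (Am G) [s..<t])) (1\<^sub>m (xdim G))"

text \<open>In the definitions below, \<open>mu\<close> holds the parameters of the system and \<open>mub\<close> the
  unknown multipliers.\<close>

definition lcs2_beta ::
  "dgc \<Rightarrow> (nat \<Rightarrow> nat \<Rightarrow> real vec) \<Rightarrow> (nat \<Rightarrow> nat \<Rightarrow> real vec) \<Rightarrow> nat \<Rightarrow> nat \<Rightarrow> real vec"
where
  "lcs2_beta G mu mub i k =
     transpose_mat (Nblk G i i k) *\<^sub>v (mub i k - mu i k)
     + vsum (udim G i) (\<lambda>t. transpose_mat (transition G t (k + 1) * Bm G i k) *\<^sub>v
         (transpose_mat (Mm G i t) *\<^sub>v (mub i t - mu i t))) {k + 1..<horizon G}"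

definition lcs2_u ::
  "dgc \<Rightarrow> (nat \<Rightarrow> nat \<Rightarrow> real mat) \<Rightarrow> (nat \<Rightarrow> nat \<Rightarrow> real vec) \<Rightarrow> (nat \<Rightarrow> real vec) \<Rightarrow>
   (nat \<Rightarrow> nat \<Rightarrow> real vec) \<Rightarrow> (nat \<Rightarrow> nat \<Rightarrow> real vec) \<Rightarrow> nat \<Rightarrow> nat \<Rightarrow> real vec"
where
  "lcs2_u G E mu xb b mub i k =
     - (minv (Ym G E i k) * transpose_mat (Bm G i k) * E i (k + 1) * Am G k *\<^sub>v xb k)
     - b i k + minv (Ym G E i k) *\<^sub>v lcs2_beta G mu mub i k"

definition lcs2_solution ::
  "dgc \<Rightarrow> (nat \<Rightarrow> nat \<Rightarrow> real mat) \<Rightarrow> real vec \<Rightarrow> (nat \<Rightarrow> nat \<Rightarrow> real vec) \<Rightarrow> (nat \<Rightarrow> real vec) \<Rightarrow>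
   (nat \<Rightarrow> nat \<Rightarrow> real vec) \<Rightarrow> (nat \<Rightarrow> nat \<Rightarrow> real vec) \<Rightarrow> (nat \<Rightarrow> nat \<Rightarrow> real vec) \<Rightarrow> bool"
where
  "lcs2_solution G E x0 mu xb e b mub \<longleftrightarrow>
     (\<forall>k\<in>stages G. xb k \<in> carrier_vec (xdim G)) \<and>
     (\<forall>i\<in>players G. \<forall>k\<in>stages G.
        e i k \<in> carrier_vec (xdim G) \<and> b i k \<in> carrier_vec (udim G i)) \<and>
     (\<forall>i\<in>players G. \<forall>k\<in>ctrl_stages G. mub i k \<in> carrier_vec (cdim G i)) \<and>
     xb 0 = x0 \<and>
     (\<forall>i\<in>players G. e i (horizon G) = pv G i (horizon G) \<and> b i (horizon G) = 0\<^sub>v (udim G i)) \<and>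
     (\<forall>i\<in>players G. \<forall>k\<in>ctrl_stages G.
        let A = Am G k; B = Bm G i k; M = Mm G i k; Ni = Nblk G i i k;
            E' = E i (k + 1); Y = Ym G E i k;
            beta = lcs2_beta G mu mub i k;
            ub = lcs2_u G E mu xb b mub;
            eta = vsum (xdim G) (\<lambda>j. Bm G j k *\<^sub>v ub j k) (players G - {i});
            alpha = vsum (cdim G i) (\<lambda>j. Nblk G i j k *\<^sub>v ub j k) (players G - {i})
        in
          xb (k + 1) =
            (1\<^sub>m (xdim G) - B * minv Y * transpose_mat B * E') * A *\<^sub>v xb k
            - B *\<^sub>v b i k + B * minv Y *\<^sub>v beta + eta \<and>
          e i k =
            transpose_mat A *\<^sub>v e i (k + 1) + transpose_mat A * E' *\<^sub>v eta
            - transpose_mat A * E' * B *\<^sub>v b i k + pv G i k - transpose_mat M *\<^sub>v mu i k \<and>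
          complementary (cdim G i)
            (Ni * minv Y *\<^sub>v beta + (M - Ni * minv Y * transpose_mat B * E' * A) *\<^sub>v xb k
              - Ni *\<^sub>v b i k + alpha + rv G i k)
            (mub i k) \<and>
          Y *\<^sub>v b i k =
            transpose_mat B *\<^sub>v (E' *\<^sub>v eta + e i (k + 1)) - transpose_mat Ni *\<^sub>v mu i k)"

definition lcs2_consistent ::
  "dgc \<Rightarrow> (nat \<Rightarrow> nat \<Rightarrow> real vec) \<Rightarrow> (nat \<Rightarrow> nat \<Rightarrow> real vec) \<Rightarrow> bool"
where
  "lcs2_consistent G mu mub \<longleftrightarrow> (\<forall>i\<in>players G. \<forall>k\<in>ctrl_stages G. mub i k = mu i k)"

end

theory Submission
  imports Defs
begin

text \<open>
  Put $\lambda = e + E x^\star$ into the stationarity condition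
  $R u = N' \mu - B' \lambda_{+}$, expand $x^\star_{+} = A x^\star + B u + \eta$, and collect the
  terms in $u$: this gives $Y u = - B' E_{+} A x^\star - Y b$, so the LCS1 control is the LCS2
  feedback. Since $\bar\mu = \mu^\star$ makes $\beta$ vanish, the state equation and the
  complementarity condition of LCS2 are those of LCS1, and the Riccati equation turns the costate
  recursion for $\lambda$ into the one for $e$.
\<close>

section \<open>Inverses of real matrices\<close>

lemma minv_inverse:
  fixes A :: "real mat"
  assumes A: "A \<in> carrier_mat n n" and inv: "invertible_mat A"
  shows "minv A \<in> carrier_mat n n" "minv A * A = 1\<^sub>m n" "A * minv A = 1\<^sub>m n"
proof -
  obtain B where B: "A * B = 1\<^sub>m n" "B * A = 1\<^sub>m (dim_row B)"
    using A inv unfolding invertible_mat_def inverts_mat_def by auto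
  \<comment> \<open>Invertibility supplies a two-sided inverse without its shape; comparing the
    numbers of columns in the two product equations shows that \<open>B\<close> is square of size
    \<open>n\<close>.\<close>
  have "dim_row B = n" "dim_col B = n"
    using arg_cong[OF B(1), of dim_col] arg_cong[OF B(2), of dim_col] A by auto
  \<comment> \<open>Membership in the units of the matrix ring excludes the outcome
    \<open>None\<close> of \<open>mat_inverse\<close>, so \<open>minv A\<close> is a genuine
    inverse.\<close>
  with B have "A \<in> Units (ring_mat TYPE(real) n ())"
    using A unfolding Units_def ring_mat_simps by auto
  then obtain C where C: "mat_inverse A = Some C"
    using mat_inverse(1)[OF A, of "()"] by (cases "mat_inverse A") auto
  have "minv A = C" unfolding minv_def C by simp
  with mat_inverse(2)[OF A C]
  show "minv A \<in> carrier_mat n n" "minv A * A = 1\<^sub>m n" "A * minv A = 1\<^sub>m n" by auto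
qed

text \<open>A nonzero kernel vector would make the quadratic form vanish, so the determinant is
  nonzero. This makes \<open>minv\<close> meaningful on the control weights R^{ii}.\<close>

lemma pos_def_invertible:
  assumes "pos_def n A"
  shows "invertible_mat A"
proof -
  have A: "A \<in> carrier_mat n n" using assms by (simp add: pos_def_def)
  have "det A \<noteq> 0"
  proof
    assume "det A = 0"
    then obtain v where v: "v \<in> carrier_vec n" "v \<noteq> 0\<^sub>v n" "A *\<^sub>v v = 0\<^sub>v n"
      using det_0_iff_vec_prod_zero_field[OF A] by auto
    with assms have "qform A v > 0" by (simp add: pos_def_def)
    with v show False by (simp add: qform_def)
  qed
  from det_non_zero_imp_unit[OF A this, of "()"]
  obtain B where "B \<in> carrier_mat n n" "A * B = 1\<^sub>m n" "B * A = 1\<^sub>m n"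
    unfolding Units_def ring_mat_simps by auto
  with A show ?thesis unfolding invertible_mat_def inverts_mat_def by auto
qed

section \<open>Finite sums of vectors of a fixed dimension\<close>

lemma vsum_carrier:
  assumes "\<And>j. j \<in> S \<Longrightarrow> f j \<in> carrier_vec d"
  shows "vsum d f S \<in> carrier_vec d"
  using assms by (intro finsum_vec_closed) auto

lemma vsum_zero:
  assumes "finite S" "\<And>j. j \<in> S \<Longrightarrow> f j = 0\<^sub>v d"
  shows "vsum d f S = 0\<^sub>v d"
proof -
  have "vsum d f S \<in> carrier_vec d" using assms(2) by (intro vsum_carrier) auto
  then show ?thesis using assms by (intro eq_vecI) (auto simp: index_finsum_vec)
qed

lemma vsum_uminus:
  assumes "finite S" "\<And>j. j \<in> S \<Longrightarrow> f j \<in> carrier_vec d"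
  shows "vsum d (\<lambda>j. - f j) S = - vsum d f S"
proof -
  have 1: "vsum d (\<lambda>j. - f j) S \<in> carrier_vec d" "vsum d f S \<in> carrier_vec d"
    using assms(2) by (auto intro!: vsum_carrier)
  have 2: "(- f j) $ i = - (f j $ i)" if "j \<in> S" "i < d" for i j
    using assms(2)[OF that(1)] that(2) by simp
  show ?thesis using 1 2 assms
    by (intro eq_vecI) (auto simp: index_finsum_vec sum_negf)
qed

lemma vsum_cong:
  assumes "finite S" "\<And>j. j \<in> S \<Longrightarrow> f j \<in> carrier_vec d" "\<And>j. j \<in> S \<Longrightarrow> f j = g j"
  shows "vsum d f S = vsum d g S"
proof -
  have g: "\<And>j. j \<in> S \<Longrightarrow> g j \<in> carrier_vec d" using assms by metis
  have "vsum d f S \<in> carrier_vec d" "vsum d g S \<in> carrier_vec d"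
    using assms(2) g by (auto intro!: vsum_carrier)
  then show ?thesis using assms g
    by (intro eq_vecI) (auto simp: index_finsum_vec intro!: sum.cong)
qed

text \<open>Separates the term of one player from the sum over the opponents, which is how LCS2
  reads the dynamics and the constraints.\<close>

lemma vsum_remove:
  assumes "finite S" "i \<in> S" "\<And>j. j \<in> S \<Longrightarrow> f j \<in> carrier_vec d"
  shows "vsum d f S = f i + vsum d f (S - {i})"
  using finsum_vec_insert[of "S - {i}" i f d] assms by (auto simp: insert_absorb)

section \<open>Matrix-vector algebra of a single stage\<close>

lemma mult_mat_vec_uminus:
  fixes A :: "'a :: comm_ring_1 mat"
  assumes A: "A \<in> carrier_mat nr nc" and v: "v \<in> carrier_vec nc"
  shows "A *\<^sub>v (- v) = - (A *\<^sub>v v)"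
proof -
  have "A *\<^sub>v (0\<^sub>v nc - v) = A *\<^sub>v 0\<^sub>v nc - A *\<^sub>v v"
    using A v by (intro mult_minus_distrib_mat_vec) auto
  moreover have "A *\<^sub>v 0\<^sub>v nc = 0\<^sub>v nr" using A by (intro eq_vecI) auto
  ultimately show ?thesis using A v by auto
qed

text \<open>Since \<open>xn\<close> contains \<open>u\<close>, the stationarity condition is
  implicit in \<open>u\<close>. Moving B'E'Bu to the left produces Y = R + B'E'B, and the left
  inverse \<open>Yi\<close> then solves for \<open>u\<close>. Here
  \<open>e' + E' *\<^sub>v xn\<close> plays the costate at the next stage, \<open>q\<close> the
  multiplier term N'mu and \<open>\<eta>\<close> the effect of the opponents; the second subtracted
  term is the affine part b.\<close>

lemma stationary_control_feedback:
  fixes A B E' R Yi :: "real mat"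
  assumes A: "A \<in> carrier_mat n n" and B: "B \<in> carrier_mat n m" and E': "E' \<in> carrier_mat n n"
    and R: "R \<in> carrier_mat m m" and Yi: "Yi \<in> carrier_mat m m"
    and inv: "Yi * (R + transpose_mat B * E' * B) = 1\<^sub>m m"
    and x: "x \<in> carrier_vec n" and \<eta>: "\<eta> \<in> carrier_vec n" and e': "e' \<in> carrier_vec n"
    and q: "q \<in> carrier_vec m" and u: "u \<in> carrier_vec m"
    and xn: "xn = A *\<^sub>v x + (B *\<^sub>v u + \<eta>)"
    and stat: "R *\<^sub>v u = q - transpose_mat B *\<^sub>v (e' + E' *\<^sub>v xn)"
  shows "u = - (Yi * transpose_mat B * E' * A *\<^sub>v x)
    - Yi *\<^sub>v (transpose_mat B *\<^sub>v (E' *\<^sub>v \<eta> + e') - q)"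
proof -
  let ?T = "transpose_mat B" and ?Y = "R + transpose_mat B * E' * B"
  have T: "?T \<in> carrier_mat m n" using B by simp
  have Y: "?Y \<in> carrier_mat m m" using R T E' B by simp
  \<comment> \<open>These are the four contributions to B' times the next costate: from the drift,
    from the own control, from the opponents and from \<open>e'\<close>.\<close>
  define a where "a = ?T *\<^sub>v (E' *\<^sub>v (A *\<^sub>v x))"
  define c where "c = ?T *\<^sub>v (E' *\<^sub>v (B *\<^sub>v u))"
  define h where "h = ?T *\<^sub>v (E' *\<^sub>v \<eta>)"
  define l where "l = ?T *\<^sub>v e'"
  have car: "a \<in> carrier_vec m" "c \<in> carrier_vec m" "h \<in> carrier_vec m" "l \<in> carrier_vec m"
    using T E' A B x u \<eta> e' unfolding a_def c_def h_def l_def by auto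
  have Ax: "A *\<^sub>v x \<in> carrier_vec n" and Bu: "B *\<^sub>v u \<in> carrier_vec n"
    using A B x u by auto
  have Exn: "E' *\<^sub>v xn = E' *\<^sub>v (A *\<^sub>v x) + (E' *\<^sub>v (B *\<^sub>v u) + E' *\<^sub>v \<eta>)"
    unfolding xn using E' Ax Bu \<eta> by (simp add: mult_add_distrib_mat_vec[OF E'])
  have Txn: "?T *\<^sub>v (e' + E' *\<^sub>v xn) = l + (a + (c + h))"
    unfolding Exn a_def c_def h_def l_def using E' Ax Bu \<eta> e'
    by (simp add: mult_add_distrib_mat_vec[OF T])
  have g: "?T *\<^sub>v (E' *\<^sub>v \<eta> + e') = h + l"
    unfolding h_def l_def using E' \<eta> e' by (simp add: mult_add_distrib_mat_vec[OF T])
  have "?Y *\<^sub>v u = R *\<^sub>v u + c"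
    unfolding c_def using R T E' B u
    by (subst add_mult_distrib_mat_vec[of _ m m])
      (auto simp: assoc_mult_mat_vec[of ?T m n "E' * B" m] assoc_mult_mat_vec[of E' n n B m])
  \<comment> \<open>The summand \<open>c\<close> of \<open>?Y *\<^sub>v u\<close> cancels the one in
    the stationarity condition, which leaves a right-hand side free of \<open>u\<close>.\<close>
  also have "\<dots> = - a - (h + l - q)"
    unfolding stat Txn using car q by (intro eq_vecI) auto
  finally have Yu: "?Y *\<^sub>v u = - a - (h + l - q)" .
  have "u = (Yi * ?Y) *\<^sub>v u" unfolding inv using u by simp
  also have "\<dots> = Yi *\<^sub>v (?Y *\<^sub>v u)" using Yi Y u by (rule assoc_mult_mat_vec)
  also have "\<dots> = - (Yi *\<^sub>v a) - Yi *\<^sub>v (h + l - q)"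
    unfolding Yu using Yi car q
    by (subst mult_minus_distrib_mat_vec[of _ m m]) (auto simp: mult_mat_vec_uminus)
  also have "Yi *\<^sub>v a = Yi * ?T * E' * A *\<^sub>v x"
  proof -
    have YT: "Yi * ?T \<in> carrier_mat m n" and YTE: "Yi * ?T * E' \<in> carrier_mat m n"
      and EAx: "E' *\<^sub>v (A *\<^sub>v x) \<in> carrier_vec n"
      using Yi T E' Ax by auto
    show ?thesis
      unfolding a_def assoc_mult_mat_vec[OF YTE A x] assoc_mult_mat_vec[OF YT E' Ax]
        assoc_mult_mat_vec[OF Yi T EAx] ..
  qed
  finally show ?thesis unfolding g .
qed

text \<open>Regrouping makes the gain \<open>Yi * C * D\<close> a single factor. The rectangular
  shapes serve two uses: \<open>A\<close> is the identity for the state equation and the constraint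
  matrix M for the complementarity condition.\<close>

lemma closed_loop_mult:
  fixes A B Yi C D :: "'a :: comm_ring_1 mat"
  assumes A: "A \<in> carrier_mat n p" and B: "B \<in> carrier_mat n m" and Yi: "Yi \<in> carrier_mat m m"
    and C: "C \<in> carrier_mat m q" and D: "D \<in> carrier_mat q p" and x: "x \<in> carrier_vec p"
  shows "(A - B * Yi * C * D) *\<^sub>v x = A *\<^sub>v x - B *\<^sub>v (Yi * C * D *\<^sub>v x)"
proof -
  have "B * Yi * C * D = B * (Yi * C * D)"
    using B Yi C D by (simp add: assoc_mult_mat[of _ n m _ m _ q] assoc_mult_mat[of _ n m _ q _ p])
  then show ?thesis using A B Yi C D x
    by (simp add: minus_mult_distrib_mat_vec[of _ n p] assoc_mult_mat_vec[of _ n m _ p])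
qed

text \<open>Applies \<open>closed_loop_mult\<close> with the identity to the vector
  \<open>A *\<^sub>v x\<close> and moves \<open>A\<close> back into the gain.\<close>

lemma closed_loop_state:
  fixes A B Yi T E' :: "'a :: comm_ring_1 mat"
  assumes A: "A \<in> carrier_mat n n" and B: "B \<in> carrier_mat n m" and Yi: "Yi \<in> carrier_mat m m"
    and T: "T \<in> carrier_mat m n" and E': "E' \<in> carrier_mat n n" and x: "x \<in> carrier_vec n"
  shows "(1\<^sub>m n - B * Yi * T * E') * A *\<^sub>v x = A *\<^sub>v x - B *\<^sub>v (Yi * T * E' * A *\<^sub>v x)"
proof -
  have Ax: "A *\<^sub>v x \<in> carrier_vec n" using A x by simp
  have "(1\<^sub>m n - B * Yi * T * E') * A *\<^sub>v x = (1\<^sub>m n - B * Yi * T * E') *\<^sub>v (A *\<^sub>v x)"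
    using A B Yi T E' x by (intro assoc_mult_mat_vec[of _ n n]) auto
  also have "\<dots> = 1\<^sub>m n *\<^sub>v (A *\<^sub>v x) - B *\<^sub>v (Yi * T * E' *\<^sub>v (A *\<^sub>v x))"
    using one_carrier_mat B Yi T E' Ax by (rule closed_loop_mult)
  also have "\<dots> = A *\<^sub>v x - B *\<^sub>v (Yi * T * E' * A *\<^sub>v x)"
    using A B Yi T E' x Ax by (simp add: assoc_mult_mat_vec[of _ m n A n])
  finally show ?thesis .
qed

text \<open>Read \<open>l'\<close> as the next costate and \<open>w\<close> as M'mu: the left side
  is the LCS1 costate minus Ex, and \<open>l' - E' *\<^sub>v xn\<close> is the next e. On the left
  the Riccati equation cancels Qx; on the right the \<open>\<eta>\<close> and \<open>b\<close> terms
  hidden in \<open>xn\<close> cancel the explicit ones. Both sides reduce to the same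
  expression.\<close>

lemma riccati_costate:
  fixes A B E' E Q Yi :: "real mat"
  assumes A: "A \<in> carrier_mat n n" and B: "B \<in> carrier_mat n m" and E': "E' \<in> carrier_mat n n"
    and Q: "Q \<in> carrier_mat n n" and Yi: "Yi \<in> carrier_mat m m"
    and x: "x \<in> carrier_vec n" and \<eta>: "\<eta> \<in> carrier_vec n" and l': "l' \<in> carrier_vec n"
    and p: "p \<in> carrier_vec n" and w: "w \<in> carrier_vec n" and b: "b \<in> carrier_vec m"
    and E: "E = transpose_mat A * E' * A + Q
      - transpose_mat A * E' * B * Yi * transpose_mat B * E' * A"
    and u: "u = - (Yi * transpose_mat B * E' * A *\<^sub>v x) - b"
    and xn: "xn = A *\<^sub>v x + (B *\<^sub>v u + \<eta>)"
  shows "(Q *\<^sub>v x + p + transpose_mat A *\<^sub>v l' - w) - E *\<^sub>v x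
    = transpose_mat A *\<^sub>v (l' - E' *\<^sub>v xn) + transpose_mat A * E' *\<^sub>v \<eta>
      - transpose_mat A * E' * B *\<^sub>v b + p - w"
proof -
  let ?T = "transpose_mat B" and ?S = "transpose_mat A" and ?P = "transpose_mat A * E'"
  have T: "?T \<in> carrier_mat m n" and S: "?S \<in> carrier_mat n n" using A B by auto
  then have P: "?P \<in> carrier_mat n n" using E' by simp
  \<comment> \<open>With \<open>u\<close> equal to -v - b, the vectors \<open>f\<close>,
    \<open>g\<close>, \<open>h\<close>, \<open>k\<close> are the images under A'E' of the pieces Ax,
    Bv, Bb and \<open>\<eta>\<close> that make up \<open>xn\<close>.\<close>
  define v where "v = Yi * ?T * E' * A *\<^sub>v x"
  have v: "v \<in> carrier_vec m" unfolding v_def using Yi T E' A x by (auto intro!: mult_mat_vec_carrier)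
  define f where "f = ?P *\<^sub>v (A *\<^sub>v x)"
  define g where "g = ?P *\<^sub>v (B *\<^sub>v v)"
  define h where "h = ?P *\<^sub>v (B *\<^sub>v b)"
  define k where "k = ?P *\<^sub>v \<eta>"
  have Ax: "A *\<^sub>v x \<in> carrier_vec n" and Bv: "B *\<^sub>v v \<in> carrier_vec n"
    and Bb: "B *\<^sub>v b \<in> carrier_vec n" using A B x v b by auto
  then have car: "f \<in> carrier_vec n" "g \<in> carrier_vec n" "h \<in> carrier_vec n" "k \<in> carrier_vec n"
    "Q *\<^sub>v x \<in> carrier_vec n" "?S *\<^sub>v l' \<in> carrier_vec n"
    using P \<eta> Q S x l' unfolding f_def g_def h_def k_def by (auto intro!: mult_mat_vec_carrier)
  have Bu: "B *\<^sub>v u = - (B *\<^sub>v v) - B *\<^sub>v b"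
    unfolding u v_def[symmetric] using B v b
    by (subst mult_minus_distrib_mat_vec[OF B]) (auto simp: mult_mat_vec_uminus)
  have "xn = (A *\<^sub>v x - B *\<^sub>v v) + (\<eta> - B *\<^sub>v b)"
    unfolding xn Bu using Ax Bv Bb \<eta>
    by (intro eq_vecI) (auto simp del: index_mult_mat_vec dim_mult_mat_vec)
  then have Pxn: "?P *\<^sub>v xn = (f - g) + (k - h)"
    unfolding f_def g_def h_def k_def using Ax Bv Bb \<eta>
    by (simp add: mult_add_distrib_mat_vec[OF P] mult_minus_distrib_mat_vec[OF P])
  have xnc: "xn \<in> carrier_vec n" unfolding xn Bu using Ax Bv Bb \<eta> by simp
  have e': "?S *\<^sub>v (l' - E' *\<^sub>v xn) = ?S *\<^sub>v l' - ((f - g) + (k - h))"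
    unfolding Pxn[symmetric] using S E' l' xnc
    by (simp add: mult_minus_distrib_mat_vec[OF S] assoc_mult_mat_vec[OF S E'])
  have PB: "?P * B \<in> carrier_mat n m" and YT: "Yi * ?T \<in> carrier_mat m n"
    and YTE: "Yi * ?T * E' \<in> carrier_mat m n" and YTEA: "Yi * ?T * E' * A \<in> carrier_mat m n"
    and PA: "?P * A \<in> carrier_mat n n" and PAQ: "?P * A + Q \<in> carrier_mat n n"
    using P A B Q Yi T E' by auto
  \<comment> \<open>Grouping the last Riccati term as A'E'B times the gain makes its value at
    \<open>x\<close> equal to \<open>g\<close>.\<close>
  have E_eq: "E = ?P * A + Q - ?P * B * (Yi * ?T * E' * A)"
    unfolding E assoc_mult_mat[OF PB Yi T] assoc_mult_mat[OF PB YT E']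
      assoc_mult_mat[OF PB YTE A] ..
  have "E *\<^sub>v x = f + Q *\<^sub>v x - g"
    unfolding E_eq f_def g_def minus_mult_distrib_mat_vec[OF PAQ mult_carrier_mat[OF PB YTEA] x]
      add_mult_distrib_mat_vec[OF PA Q x] assoc_mult_mat_vec[OF P A x]
      assoc_mult_mat_vec[OF PB YTEA x] v_def[symmetric] assoc_mult_mat_vec[OF P B v] ..
  moreover have "?P * B *\<^sub>v b = h" unfolding h_def using P B b by (rule assoc_mult_mat_vec)
  ultimately show ?thesis
    unfolding e' k_def[symmetric] using car p w
    by (intro eq_vecI) (auto simp del: index_mult_mat_vec dim_mult_mat_vec)
qed

theorem theorem2:
  fixes G :: dgc
    and E :: "nat \<Rightarrow> nat \<Rightarrow> real mat"
    and x0 :: "real vec"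
    and xs xb :: "nat \<Rightarrow> real vec"
    and lam mus mub ub e b :: "nat \<Rightarrow> nat \<Rightarrow> real vec"
  assumes game: "valid_dgc G"
    and A1: "assumption1 G"
    and A2: "riccati_solution G E"
    and x0: "x0 \<in> feasible_init G"
    and lcs1: "lcs1_solution G x0 xs lam mus"
    and ub: "\<forall>i\<in>players G. \<forall>k\<in>ctrl_stages G.
      ub i k = - (minv (Rm G i i k) *\<^sub>v
        (transpose_mat (Bm G i k) *\<^sub>v lam i (k + 1) - transpose_mat (Nblk G i i k) *\<^sub>v mus i k))"
    and e: "\<forall>i\<in>players G. \<forall>k\<in>stages G. e i k = lam i k - E i k *\<^sub>v xs k"
    and b: "\<forall>i\<in>players G. \<forall>k\<in>ctrl_stages G.
      b i k = minv (Ym G E i k) *\<^sub>v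
        (transpose_mat (Bm G i k) *\<^sub>v
           (E i (k + 1) *\<^sub>v vsum (xdim G) (\<lambda>j. Bm G j k *\<^sub>v ub j k) (players G - {i}) + e i (k + 1))
         - transpose_mat (Nblk G i i k) *\<^sub>v mus i k)"
    and bK: "\<forall>i\<in>players G. b i (horizon G) = 0\<^sub>v (udim G i)"
    and xb: "\<forall>k\<in>stages G. xb k = xs k"
    and mub: "\<forall>i\<in>players G. \<forall>k\<in>ctrl_stages G. mub i k = mus i k"
  shows "lcs2_solution G E x0 mus xb e b mub \<and> lcs2_consistent G mus mub"
proof -

  \<comment> \<open>Dimensions and inverses of the game data\<close>
  let ?n = "xdim G" and ?K = "horizon G" and ?P = "players G"
  have finP: "finite ?P" by (simp add: players_def)
  have kS: "k \<in> stages G" "Suc k \<in> stages G" if "k \<in> ctrl_stages G" for k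
    using that by (auto simp: ctrl_stages_def stages_def)
  have KS: "?K \<in> stages G" by (simp add: stages_def)
  have Ac: "Am G k \<in> carrier_mat ?n ?n" if "k \<in> ctrl_stages G" for k
    using game that by (simp add: valid_dgc_def)
  have dims: "Bm G i k \<in> carrier_mat ?n (udim G i)" "Mm G i k \<in> carrier_mat (cdim G i) ?n"
    "rv G i k \<in> carrier_vec (cdim G i)" "Rm G i i k \<in> carrier_mat (udim G i) (udim G i)"
    if "i \<in> ?P" "k \<in> ctrl_stages G" for i k
    using game that by (auto simp: valid_dgc_def)
  have Qc: "Qm G i k \<in> carrier_mat ?n ?n" and pc: "pv G i k \<in> carrier_vec ?n"
    if "i \<in> ?P" "k \<in> stages G" for i k
    using game that by (auto simp: valid_dgc_def)
  have Nc: "Nblk G i j k \<in> carrier_mat (cdim G i) (udim G j)" for i j k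
    by (simp add: Nblk_def)
  have Ec: "E i k \<in> carrier_mat ?n ?n" if "i \<in> ?P" "k \<in> stages G" for i k
    using A2 that by (simp add: riccati_solution_def)
  have Yc: "Ym G E i k \<in> carrier_mat (udim G i) (udim G i)"
    if "i \<in> ?P" "k \<in> ctrl_stages G" for i k
    using dims[OF that] Ec[OF that(1) kS(2)[OF that(2)]] by (simp add: Ym_def)
  have Yinv: "minv (Ym G E i k) \<in> carrier_mat (udim G i) (udim G i)"
    "minv (Ym G E i k) * Ym G E i k = 1\<^sub>m (udim G i)"
    "Ym G E i k * minv (Ym G E i k) = 1\<^sub>m (udim G i)"
    if "i \<in> ?P" "k \<in> ctrl_stages G" for i k
    using minv_inverse[OF Yc[OF that]] A2 that by (simp_all add: riccati_solution_def)
  have Rinv: "minv (Rm G i i k) \<in> carrier_mat (udim G i) (udim G i)"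
    "Rm G i i k * minv (Rm G i i k) = 1\<^sub>m (udim G i)"
    if "i \<in> ?P" "k \<in> ctrl_stages G" for i k
  proof -
    have "pos_def (udim G i) (Rm G i i k)" using A1 that by (simp add: assumption1_def)
    from minv_inverse[OF dims(4)[OF that] pos_def_invertible[OF this]]
    show "minv (Rm G i i k) \<in> carrier_mat (udim G i) (udim G i)"
      "Rm G i i k * minv (Rm G i i k) = 1\<^sub>m (udim G i)" by auto
  qed
  have xc: "xs k \<in> carrier_vec ?n" if "k \<in> stages G" for k
    using lcs1 that by (simp add: lcs1_solution_def)
  have lc: "lam i k \<in> carrier_vec ?n" if "i \<in> ?P" "k \<in> stages G" for i k
    using lcs1 that by (simp add: lcs1_solution_def)
  have muc: "mus i k \<in> carrier_vec (cdim G i)" if "i \<in> ?P" "k \<in> ctrl_stages G" for i k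
    using lcs1 that by (simp add: lcs1_solution_def)
  have ec: "e i k \<in> carrier_vec ?n" if "i \<in> ?P" "k \<in> stages G" for i k
    using e that lc[OF that] Ec[OF that] xc[OF that(2)] by simp

  \<comment> \<open>The LCS1 controls and the trajectory they generate\<close>
  define q where "q i k = transpose_mat (Nblk G i i k) *\<^sub>v mus i k" for i k
  \<comment> \<open>The vector B'lambda - N'mu occurs in the control formula, in the state equation
    and in the complementarity condition of LCS1.\<close>
  define s where "s i k = transpose_mat (Bm G i k) *\<^sub>v lam i (Suc k) - q i k" for i k
  define eta where "eta i k = vsum ?n (\<lambda>j. Bm G j k *\<^sub>v ub j k) (?P - {i})" for i k
  have qc: "q i k \<in> carrier_vec (udim G i)" if "i \<in> ?P" "k \<in> ctrl_stages G" for i k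
    unfolding q_def using Nc[of i i k] muc[OF that] by simp
  have sc: "s i k \<in> carrier_vec (udim G i)" if "i \<in> ?P" "k \<in> ctrl_stages G" for i k
    unfolding s_def using qc[OF that] dims[OF that] lc[OF that(1) kS(2)[OF that(2)]] by simp
  have ubs: "ub i k = - (minv (Rm G i i k) *\<^sub>v s i k)" if "i \<in> ?P" "k \<in> ctrl_stages G" for i k
    using ub that by (simp add: s_def q_def)
  have uc: "ub i k \<in> carrier_vec (udim G i)" if "i \<in> ?P" "k \<in> ctrl_stages G" for i k
    unfolding ubs[OF that] using Rinv[OF that] sc[OF that] by simp
  \<comment> \<open>This is the stationarity in u of the Hamiltonian with costate lambda and
    constraint multiplier mu; the right inverse of R yields it.\<close>
  have stat: "Rm G i i k *\<^sub>v ub i k = - s i k" if "i \<in> ?P" "k \<in> ctrl_stages G" for i k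
  proof -
    have "Rm G i i k *\<^sub>v ub i k = - ((Rm G i i k * minv (Rm G i i k)) *\<^sub>v s i k)"
      unfolding ubs[OF that] using dims(4)[OF that] Rinv(1)[OF that] sc[OF that]
      by (simp add: mult_mat_vec_uminus[of _ "udim G i" "udim G i"])
    then show ?thesis using Rinv(2)[OF that] sc[OF that] by simp
  qed
  \<comment> \<open>\<open>F\<close> is left general because the identity is needed for the input
    matrices B in the state equation and for the blocks of N in the constraints.\<close>
  have neg_sum: "vsum d (\<lambda>j. F j *\<^sub>v (minv (Rm G j j k) *\<^sub>v s j k)) ?P
      = - vsum d (\<lambda>j. F j *\<^sub>v ub j k) ?P"
    if k: "k \<in> ctrl_stages G" and F: "\<And>j. j \<in> ?P \<Longrightarrow> F j \<in> carrier_mat d (udim G j)" for d F k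
  proof -
    have r: "minv (Rm G j j k) *\<^sub>v s j k \<in> carrier_vec (udim G j)" if "j \<in> ?P" for j
      using Rinv(1)[OF that k] sc[OF that k] by simp
    have c: "F j *\<^sub>v (minv (Rm G j j k) *\<^sub>v s j k) \<in> carrier_vec d" if "j \<in> ?P" for j
      using F[OF that] r[OF that] by simp
    have "vsum d (\<lambda>j. F j *\<^sub>v ub j k) ?P
        = vsum d (\<lambda>j. - (F j *\<^sub>v (minv (Rm G j j k) *\<^sub>v s j k))) ?P"
    proof (rule vsum_cong[OF finP])
      fix j assume j: "j \<in> ?P"
      show "F j *\<^sub>v ub j k \<in> carrier_vec d" using F[OF j] uc[OF j k] by simp
      show "F j *\<^sub>v ub j k = - (F j *\<^sub>v (minv (Rm G j j k) *\<^sub>v s j k))"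
        unfolding ubs[OF j k] using F[OF j] r[OF j] by (rule mult_mat_vec_uminus)
    qed
    also have "\<dots> = - vsum d (\<lambda>j. F j *\<^sub>v (minv (Rm G j j k) *\<^sub>v s j k)) ?P"
      using finP c by (rule vsum_uminus)
    finally show ?thesis by simp
  qed
  have Bu: "Bm G j k *\<^sub>v ub j k \<in> carrier_vec ?n" if "j \<in> ?P" "k \<in> ctrl_stages G" for j k
    using dims[OF that] uc[OF that] by simp
  have Nu: "Nblk G i j k *\<^sub>v ub j k \<in> carrier_vec (cdim G i)"
    if "j \<in> ?P" "k \<in> ctrl_stages G" for i j k
    using Nc[of i j k] uc[OF that] by simp
  have etac: "eta i k \<in> carrier_vec ?n" if "k \<in> ctrl_stages G" for i k
    unfolding eta_def using Bu that by (intro vsum_carrier) auto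
  \<comment> \<open>The same state equation is written from the viewpoint of each player
    \<open>i\<close>, with the opponents collected in \<open>eta i k\<close>.\<close>
  have xnext: "xs (Suc k) = Am G k *\<^sub>v xs k + (Bm G i k *\<^sub>v ub i k + eta i k)"
    if "i \<in> ?P" "k \<in> ctrl_stages G" for i k
  proof -
    have "xs (Suc k) = Am G k *\<^sub>v xs k
        - vsum ?n (\<lambda>j. Bm G j k *\<^sub>v (minv (Rm G j j k) *\<^sub>v s j k)) ?P"
      using lcs1 that(2) by (simp add: lcs1_solution_def s_def q_def)
    also have "vsum ?n (\<lambda>j. Bm G j k *\<^sub>v (minv (Rm G j j k) *\<^sub>v s j k)) ?P
        = - vsum ?n (\<lambda>j. Bm G j k *\<^sub>v ub j k) ?P"
      using that(2) dims(1)[OF _ that(2)] by (rule neg_sum)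
    also have "vsum ?n (\<lambda>j. Bm G j k *\<^sub>v ub j k) ?P = Bm G i k *\<^sub>v ub i k + eta i k"
      unfolding eta_def using finP that(1) Bu[OF _ that(2)] by (rule vsum_remove)
    finally show ?thesis
      using Ac[OF that(2)] xc[OF kS(1)[OF that(2)]] Bu[OF that] etac[OF that(2), of i] by auto
  qed

  \<comment> \<open>Feedback form of the controls\<close>
  have bdef: "b i k = minv (Ym G E i k) *\<^sub>v
      (transpose_mat (Bm G i k) *\<^sub>v (E i (Suc k) *\<^sub>v eta i k + e i (Suc k)) - q i k)"
    if "i \<in> ?P" "k \<in> ctrl_stages G" for i k
    using b that by (simp add: eta_def q_def)
  have rc: "transpose_mat (Bm G i k) *\<^sub>v (E i (Suc k) *\<^sub>v eta i k + e i (Suc k)) - q i k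
      \<in> carrier_vec (udim G i)" if "i \<in> ?P" "k \<in> ctrl_stages G" for i k
    using dims(1)[OF that] Ec[OF that(1) kS(2)[OF that(2)]] etac[OF that(2)]
      ec[OF that(1) kS(2)[OF that(2)]] qc[OF that] by simp
  have bc: "b i k \<in> carrier_vec (udim G i)" if "i \<in> ?P" "k \<in> ctrl_stages G" for i k
    unfolding bdef[OF that] using Yinv(1)[OF that] rc[OF that] by simp
  have ufb: "ub i k = - (minv (Ym G E i k) * transpose_mat (Bm G i k) * E i (Suc k) * Am G k
      *\<^sub>v xs k) - b i k" if "i \<in> ?P" "k \<in> ctrl_stages G" for i k
    unfolding bdef[OF that]
  proof (rule stationary_control_feedback)
    note k' = kS(2)[OF that(2)]
    show "minv (Ym G E i k) * (Rm G i i k + transpose_mat (Bm G i k) * E i (Suc k) * Bm G i k)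
        = 1\<^sub>m (udim G i)"
      using Yinv(2)[OF that] by (simp add: Ym_def)
    \<comment> \<open>The definition of \<open>e\<close> is inverted at the next stage, so that the
      costate takes the form required by the feedback lemma.\<close>
    have "e i (Suc k) + E i (Suc k) *\<^sub>v xs (Suc k) = lam i (Suc k)"
      using e that(1) k' Ec[OF that(1) k'] lc[OF that(1) k'] xc[OF k'] by auto
    then show "Rm G i i k *\<^sub>v ub i k = q i k
        - transpose_mat (Bm G i k) *\<^sub>v (e i (Suc k) + E i (Suc k) *\<^sub>v xs (Suc k))"
      unfolding stat[OF that] s_def
      using qc[OF that] dims(1)[OF that] lc[OF that(1) k'] by auto
    show "xs (Suc k) = Am G k *\<^sub>v xs k + (Bm G i k *\<^sub>v ub i k + eta i k)"
      using that by (rule xnext)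
  qed (use that kS Ac dims Ec Yinv xc etac ec qc uc in auto)

  \<comment> \<open>Vanishing of \<beta> and agreement of the LCS2 controls\<close>
  have beta0: "lcs2_beta G mus mub i k = 0\<^sub>v (udim G i)" if "i \<in> ?P" "k \<in> ctrl_stages G" for i k
  proof -
    have z: "mub i t - mus i t = 0\<^sub>v (cdim G i)" if "t \<in> ctrl_stages G" for t
      using mub muc[OF \<open>i \<in> ?P\<close> that] \<open>i \<in> ?P\<close> that by auto
    \<comment> \<open>The shape ensures that the transposed product maps zero to the zero vector of
      length \<open>udim G i\<close>. The bound \<open>t \<le> ?K\<close> keeps every factor of the
      transition product at a control stage, where its dimensions are known.\<close>
    have tr: "transition G t r * Bm G i k \<in> carrier_mat ?n (udim G i)"
      if "t \<le> ?K" for t r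
    proof -
      have "foldr (*) As (1\<^sub>m ?n) \<in> carrier_mat ?n ?n" if "set As \<subseteq> carrier_mat ?n ?n" for As
        using that by (induction As) auto
      moreover have "set (rev (map (Am G) [r..<t])) \<subseteq> carrier_mat ?n ?n"
        using Ac that by (auto simp: ctrl_stages_def)
      ultimately have "transition G t r \<in> carrier_mat ?n ?n" unfolding transition_def by blast
      then show ?thesis
        using dims(1)[OF \<open>i \<in> ?P\<close> \<open>k \<in> ctrl_stages G\<close>] by (rule mult_carrier_mat)
    qed
    have z0: "C *\<^sub>v 0\<^sub>v c = 0\<^sub>v r" if "C \<in> carrier_mat r c" for C :: "real mat" and r c
      using that by (intro eq_vecI) auto
    have "vsum (udim G i) (\<lambda>t. transpose_mat (transition G t (k + 1) * Bm G i k) *\<^sub>v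
         (transpose_mat (Mm G i t) *\<^sub>v (mub i t - mus i t))) {k + 1..<?K} = 0\<^sub>v (udim G i)"
    proof (rule vsum_zero)
      fix t assume "t \<in> {k + 1..<?K}"
      then have t: "t \<in> ctrl_stages G" "t \<le> ?K" by (auto simp: ctrl_stages_def)
      have "transpose_mat (Mm G i t) *\<^sub>v (mub i t - mus i t) = 0\<^sub>v ?n"
        unfolding z[OF t(1)] using dims(2)[OF \<open>i \<in> ?P\<close> t(1)] by (intro z0) simp
      then show "transpose_mat (transition G t (k + 1) * Bm G i k) *\<^sub>v
          (transpose_mat (Mm G i t) *\<^sub>v (mub i t - mus i t)) = 0\<^sub>v (udim G i)"
        using z0[of "transpose_mat (transition G t (k + 1) * Bm G i k)" "udim G i" ?n]
          tr[OF t(2), of "k + 1"] by simp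
    qed simp
    moreover have "transpose_mat (Nblk G i i k) *\<^sub>v (mub i k - mus i k) = 0\<^sub>v (udim G i)"
      unfolding z[OF that(2)] using Nc[of i i k] by (intro z0) simp
    ultimately show ?thesis unfolding lcs2_beta_def by simp
  qed
  have Yi0: "minv (Ym G E i k) *\<^sub>v 0\<^sub>v (udim G i) = 0\<^sub>v (udim G i)"
    if "i \<in> ?P" "k \<in> ctrl_stages G" for i k
    using Yinv(1)[OF that] by (intro eq_vecI) auto
  \<comment> \<open>Without \<beta>, the LCS2 control law is the feedback law already proved for
    \<open>ub\<close>. Hence the sums over opponents agree as well.\<close>
  have u2: "lcs2_u G E mus xb b mub i k = ub i k" if "i \<in> ?P" "k \<in> ctrl_stages G" for i k
    using xb kS[OF that(2)] uc[OF that]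
    unfolding lcs2_u_def beta0[OF that] Yi0[OF that] ufb[OF that] by simp
  have eta2: "vsum ?n (\<lambda>j. Bm G j k *\<^sub>v lcs2_u G E mus xb b mub j k) (?P - {i}) = eta i k"
    if "k \<in> ctrl_stages G" for i k
    unfolding eta_def using finP Bu u2 that by (intro vsum_cong) auto
  define al where "al i k = vsum (cdim G i) (\<lambda>j. Nblk G i j k *\<^sub>v ub j k) (?P - {i})" for i k
  have al2: "vsum (cdim G i) (\<lambda>j. Nblk G i j k *\<^sub>v lcs2_u G E mus xb b mub j k) (?P - {i})
      = al i k" if "k \<in> ctrl_stages G" for i k
    unfolding al_def using finP Nu u2 that by (intro vsum_cong) auto
  have alc: "al i k \<in> carrier_vec (cdim G i)" if "k \<in> ctrl_stages G" for i k
    unfolding al_def using Nu that by (intro vsum_carrier) auto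

  \<comment> \<open>Terminal condition and the four relations of each stage\<close>
  have eK: "e i ?K = pv G i ?K" if "i \<in> ?P" for i
  proof -
    have "lam i ?K = Qm G i ?K *\<^sub>v xs ?K + pv G i ?K"
      using lcs1 that by (simp add: lcs1_solution_def)
    \<comment> \<open>The terminal value of the Riccati solution cancels the quadratic part of the
      terminal costate, leaving the linear cost term.\<close>
    moreover have "E i ?K = Qm G i ?K" using A2 that by (simp add: riccati_solution_def)
    ultimately show ?thesis
      using e that KS Qc[OF that KS] pc[OF that KS] xc[OF KS] by auto
  qed
  \<comment> \<open>The relations appear as LCS2 reads after \<open>beta0\<close>,
    \<open>eta2\<close> and \<open>al2\<close>, with the LCS1 states and multipliers inserted; hence
    the zero vectors in the place of \<beta>.\<close>
  have stage: "xs (Suc k) = (1\<^sub>m ?n - Bm G i k * minv (Ym G E i k) * transpose_mat (Bm G i k)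
        * E i (Suc k)) * Am G k *\<^sub>v xs k - Bm G i k *\<^sub>v b i k
        + Bm G i k * minv (Ym G E i k) *\<^sub>v 0\<^sub>v (udim G i) + eta i k" (is ?state)
    "e i k = transpose_mat (Am G k) *\<^sub>v e i (Suc k)
        + transpose_mat (Am G k) * E i (Suc k) *\<^sub>v eta i k
        - transpose_mat (Am G k) * E i (Suc k) * Bm G i k *\<^sub>v b i k + pv G i k
        - transpose_mat (Mm G i k) *\<^sub>v mus i k" (is ?costate)
    "complementary (cdim G i)
        (Nblk G i i k * minv (Ym G E i k) *\<^sub>v 0\<^sub>v (udim G i)
          + (Mm G i k - Nblk G i i k * minv (Ym G E i k) * transpose_mat (Bm G i k)
              * E i (Suc k) * Am G k) *\<^sub>v xs k
          - Nblk G i i k *\<^sub>v b i k + al i k + rv G i k) (mus i k)" (is ?compl)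
    "Ym G E i k *\<^sub>v b i k = transpose_mat (Bm G i k) *\<^sub>v (E i (Suc k) *\<^sub>v eta i k + e i (Suc k))
        - transpose_mat (Nblk G i i k) *\<^sub>v mus i k" (is ?aux)
    if i: "i \<in> ?P" and k: "k \<in> ctrl_stages G" for i k
  proof -
    let ?Yi = "minv (Ym G E i k)" and ?B = "Bm G i k" and ?A = "Am G k" and ?E' = "E i (Suc k)"
      and ?T = "transpose_mat (Bm G i k)" and ?N = "Nblk G i i k" and ?M = "Mm G i k"
    note k0 = kS(1)[OF k] and k' = kS(2)[OF k]
    note A = Ac[OF k] and B = dims(1)[OF i k] and M = dims(2)[OF i k] and r = dims(3)[OF i k]
      and E' = Ec[OF i k'] and Yi = Yinv(1)[OF i k] and x = xc[OF k0] and bb = bc[OF i k]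
    have T: "?T \<in> carrier_mat (udim G i) ?n" using B by simp
    define v where "v = ?Yi * ?T * ?E' * ?A *\<^sub>v xs k"
    have v: "v \<in> carrier_vec (udim G i)"
      unfolding v_def using Yi T E' A x by (auto intro!: mult_mat_vec_carrier)
    \<comment> \<open>\<open>C\<close> will be the input matrix \<open>?B\<close> in the state
      equation and the block \<open>?N\<close> in the constraint.\<close>
    have ctrl: "C *\<^sub>v ub i k = - (C *\<^sub>v v) - C *\<^sub>v b i k"
      if C: "C \<in> carrier_mat d (udim G i)" for C d
      unfolding ufb[OF i k] v_def[symmetric] using C v bb
      by (subst mult_minus_distrib_mat_vec[OF C]) (auto simp: mult_mat_vec_uminus)
    have z: "C * ?Yi *\<^sub>v 0\<^sub>v (udim G i) = 0\<^sub>v d" if C: "C \<in> carrier_mat d (udim G i)" for C d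
    proof -
      have "C * ?Yi *\<^sub>v 0\<^sub>v (udim G i) = C *\<^sub>v 0\<^sub>v (udim G i)"
        using C Yi Yi0[OF i k] by (simp add: assoc_mult_mat_vec[OF C Yi])
      also have "\<dots> = 0\<^sub>v d" using C by (intro eq_vecI) auto
      finally show ?thesis .
    qed
    have car: "?A *\<^sub>v xs k \<in> carrier_vec ?n" "?B *\<^sub>v v \<in> carrier_vec ?n"
      "?B *\<^sub>v b i k \<in> carrier_vec ?n" "?M *\<^sub>v xs k \<in> carrier_vec (cdim G i)"
      "?N *\<^sub>v v \<in> carrier_vec (cdim G i)" "?N *\<^sub>v b i k \<in> carrier_vec (cdim G i)"
      using A B M Nc[of i i k] x v bb by auto
    show ?state
      unfolding xnext[OF i k] ctrl[OF B] z[OF B]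
        closed_loop_state[OF A B Yi T E' x] v_def[symmetric]
      using car etac[OF k, of i]
      by (intro eq_vecI) (auto simp del: index_mult_mat_vec dim_mult_mat_vec)
    have mu: "transpose_mat ?M *\<^sub>v mus i k \<in> carrier_vec ?n" using M muc[OF i k] by simp
    have "lam i k = Qm G i k *\<^sub>v xs k + pv G i k + transpose_mat ?A *\<^sub>v lam i (Suc k)
        - transpose_mat ?M *\<^sub>v mus i k"
      using lcs1 i k by (simp add: lcs1_solution_def)
    moreover have "e i k = lam i k - E i k *\<^sub>v xs k"
      "e i (Suc k) = lam i (Suc k) - ?E' *\<^sub>v xs (Suc k)"
      using e i k0 k' by auto
    moreover have "E i k = transpose_mat ?A * ?E' * ?A + Qm G i k
        - transpose_mat ?A * ?E' * ?B * ?Yi * ?T * ?E' * ?A"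
      using A2 i k by (simp add: riccati_solution_def)
    \<comment> \<open>The LCS1 recursion for \<open>lam i k\<close>, with
      \<open>E i k *\<^sub>v xs k\<close> subtracted, is the left side of
      \<open>riccati_costate\<close>, where M'mu takes the role of \<open>w\<close>.\<close>
    ultimately show ?costate
      using riccati_costate[OF A B E' Qc[OF i k0] Yi x etac[OF k] lc[OF i k'] pc[OF i k0] mu bb
          _ ufb[OF i k] xnext[OF i k]] by simp
    \<comment> \<open>The two minus signs make the LCS1 constraint value Mx plus all control terms
      plus r. Only this vector is rewritten, first by isolating player \<open>i\<close> and then by
      the feedback, so its complementarity with \<open>mus i k\<close> carries over.\<close>
    have "complementary (cdim G i)
        (?M *\<^sub>v xs k - vsum (cdim G i) (\<lambda>j. Nblk G i j k *\<^sub>v (minv (Rm G j j k) *\<^sub>v s j k)) ?P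
          + rv G i k) (mus i k)"
      using lcs1 i k by (simp add: lcs1_solution_def s_def q_def)
    also have "vsum (cdim G i) (\<lambda>j. Nblk G i j k *\<^sub>v (minv (Rm G j j k) *\<^sub>v s j k)) ?P
        = - vsum (cdim G i) (\<lambda>j. Nblk G i j k *\<^sub>v ub j k) ?P"
      using k Nc by (rule neg_sum)
    also have "vsum (cdim G i) (\<lambda>j. Nblk G i j k *\<^sub>v ub j k) ?P = ?N *\<^sub>v ub i k + al i k"
      unfolding al_def using finP i Nu[OF _ k] by (rule vsum_remove)
    also have "?M *\<^sub>v xs k - - (?N *\<^sub>v ub i k + al i k) + rv G i k
        = ?N * ?Yi *\<^sub>v 0\<^sub>v (udim G i) + (?M - ?N * ?Yi * ?T * ?E' * ?A) *\<^sub>v xs k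
          - ?N *\<^sub>v b i k + al i k + rv G i k"
    proof -
      have "?N * ?Yi * ?T * ?E' = ?N * ?Yi * (?T * ?E')"
        using Nc[of i i k] Yi T E' by (intro assoc_mult_mat[of _ "cdim G i" "udim G i" _ ?n]) auto
      moreover have "?Yi * ?T * ?E' = ?Yi * (?T * ?E')" using Yi T E' by (rule assoc_mult_mat)
      ultimately have "(?M - ?N * ?Yi * ?T * ?E' * ?A) *\<^sub>v xs k = ?M *\<^sub>v xs k - ?N *\<^sub>v v"
        using closed_loop_mult[OF M Nc Yi mult_carrier_mat[OF T E'] A x] by (simp add: v_def)
      then show ?thesis
        unfolding ctrl[OF Nc] z[OF Nc] using car r alc[OF k, of i]
        by (intro eq_vecI) (auto simp del: index_mult_mat_vec dim_mult_mat_vec)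
    qed
    finally show ?compl .
    \<comment> \<open>Here Y acts after its inverse, so the right inverse is used, whereas solving
      for the control used the left one.\<close>
    show ?aux
      unfolding bdef[OF i k] q_def[symmetric]
      using assoc_mult_mat_vec[OF Yc[OF i k] Yi rc[OF i k]] Yinv(3)[OF i k] rc[OF i k] by simp
  qed
  \<comment> \<open>LCS2 also includes \<open>b\<close> at the final stage, where the convention b_K
    = 0 supplies the dimension.\<close>
  have bcS: "b i k \<in> carrier_vec (udim G i)" if "i \<in> ?P" "k \<in> stages G" for i k
    using bc[of i k] bK that by (cases "k = ?K") (auto simp: stages_def ctrl_stages_def)
  have "xs 0 = x0" using lcs1 by (simp add: lcs1_solution_def)
  moreover have "0 \<in> stages G" by (simp add: stages_def)
  ultimately have "lcs2_solution G E x0 mus xb e b mub"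
    unfolding lcs2_solution_def Let_def
    using xb mub xc ec bcS muc bK eK stage kS by (simp add: beta0 eta2 al2)
  then show ?thesis using mub by (simp add: lcs2_consistent_def)
qed

end
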